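(* Let $k$ be an integer with $1 \le k < 10$. There exists a positive integer $M$ that is a $(10,k)$-reverse multiple if and only if $k \in \{1, 4, 9\}$.
   Context: For an integer $k$ with $1 \le k < 10$, a positive integer $M$ is called a $(10,k)$-reverse multiple if the reversal of the decimal expansion of $M$ is the decimal expansion of the product $kM$; that is, if $M$ has decimal digits $a_n a_{n-1}\cdots a_1 a_0$ (with $a_n \ne 0$), then $kM$ has decimal expansion $a_0 a_1 \cdots a_{n-1} a_n$. *)

theory Defs
  imports Main
begin

(* The entry ds ! i is the digit of weight g ^ i; thus the last entry is the leading
   digit a_n, and the final condition says a_n \<noteq> 0. *)
definition is_base_expansion :: "nat \<Rightarrow> nat list \<Rightarrow> nat \<Rightarrow> bool" where
  "is_base_expansion g ds N \<longleftrightarrow>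
     ds \<noteq> [] \<and> (\<forall>d \<in> set ds. d < g) \<and> last ds \<noteq> 0 \<and> N = horner_sum id g ds"

(* For M > 0 and g \<ge> 2 the witness ds exists and is unique: it is the base-g expansion of M. *)
definition reverse_multiple :: "nat \<Rightarrow> nat \<Rightarrow> nat \<Rightarrow> bool" where
  "reverse_multiple g k M \<longleftrightarrow>
     M > 0 \<and> (\<exists>ds. is_base_expansion g ds M \<and> is_base_expansion g (rev ds) (k * M))"

end

theory Submission
  imports Defs
begin

text \<open>
  Only the outermost digits of \<open>M\<close> matter for the negative direction. Let \<open>a\<close> be the leading and
  \<open>b\<close> the trailing digit of \<open>M\<close> in base \<open>g\<close>. Since \<open>k * M\<close> is the reversal of \<open>M\<close>, the two numbers
  have the same length, and \<open>a\<close> is the trailing and \<open>b\<close> the leading digit of \<open>k * M\<close>. Reading the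
  trailing digit gives \<open>k * b \<equiv> a\<close> modulo \<open>g\<close>. Reading the leading digit gives
  \<open>k * a \<le> b < k * (a + 1)\<close>, because a carry into the top position is at most \<open>k - 1\<close>. Both digits
  are nonzero, being leading digits of expansions (lemma \<open>reverse_multiple_outer_digits\<close>).

  For \<open>g = 10\<close> the bound \<open>k * a \<le> 9\<close> leaves few pairs \<open>(a, b)\<close>, and for \<open>k\<close> outside \<open>{1, 4, 9}\<close> the
  congruence fails for all of them. Conversely, \<open>1 = 1 * 1\<close>, \<open>8712 = 4 * 2178\<close> and
  \<open>9801 = 9 * 1089\<close> are reversals.
\<close>

lemma base_expansion_trailing_digit:
  assumes "is_base_expansion g ds N"
  shows "N mod g = hd ds"
proof (cases ds)
  case Nil
  then show ?thesis
    using assms by (simp add: is_base_expansion_def)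
next
  case (Cons d ds')
  then have "d < g" "N = d + g * horner_sum id g ds'"
    using assms by (auto simp: is_base_expansion_def)
  then show ?thesis
    using Cons by simp
qed

text \<open>The digits below the leading one contribute less than one unit of the leading position.\<close>

lemma base_expansion_leading_digit:
  assumes "is_base_expansion g ds N"
  shows "last ds * g ^ (length ds - 1) \<le> N"
    and "N < (last ds + 1) * g ^ (length ds - 1)"
proof -
  have lower_digits: "horner_sum id g es < g ^ length es" if "\<forall>d \<in> set es. d < g" for es
    using that
  proof (induction es)
    case Nil
    then show ?case by simp
  next
    case (Cons e es)
    then have "e < g" and "horner_sum id g es + 1 \<le> g ^ length es"
      by (simp_all add: Suc_le_eq id_def)
    then have "g * (horner_sum id g es + 1) \<le> g * g ^ length es"
      by (intro mult_le_mono2)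
    with \<open>e < g\<close> show ?case by (simp add: id_def)
  qed
  have "ds \<noteq> []" and digits: "\<forall>d \<in> set ds. d < g" and N: "N = horner_sum id g ds"
    using assms by (simp_all add: is_base_expansion_def)
  have "N = horner_sum id g (butlast ds @ [last ds])"
    using N \<open>ds \<noteq> []\<close> by simp
  also have "\<dots> = horner_sum id g (butlast ds) + last ds * g ^ (length ds - 1)"
    unfolding horner_sum_append by (simp add: mult.commute)
  finally have split: "N = horner_sum id g (butlast ds) + last ds * g ^ (length ds - 1)" .
  have "horner_sum id g (butlast ds) < g ^ (length ds - 1)"
    using lower_digits[of "butlast ds"] digits by (auto dest: in_set_butlastD)
  with split show "last ds * g ^ (length ds - 1) \<le> N"
    and "N < (last ds + 1) * g ^ (length ds - 1)"
    by simp_all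
qed

text \<open>
  The witnesses are the leading digit \<open>a\<close> and the trailing digit \<open>b\<close> of \<open>M\<close>; the inequalities compare
  the ranges in which the leading digits confine \<open>M\<close> and \<open>k * M\<close>.
\<close>

lemma reverse_multiple_outer_digits:
  assumes "reverse_multiple g k M"
  obtains a b where "0 < a" "a < g" "0 < b" "b < g"
    and "(k * b) mod g = a" "k * a \<le> b" "b < k * (a + 1)"
proof -
  obtain ds where M: "is_base_expansion g ds M" and kM: "is_base_expansion g (rev ds) (k * M)"
    using assms by (auto simp: reverse_multiple_def)
  define a b P where "a = last ds" and "b = hd ds" and "P = g ^ (length ds - 1)"
  have "ds \<noteq> []"
    using M by (simp add: is_base_expansion_def)
  then have digits: "0 < a" "a < g" "0 < b" "b < g"
    using M kM by (auto simp: is_base_expansion_def a_def b_def last_rev)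
  have "M mod g = b" "(k * M) mod g = a"
    using base_expansion_trailing_digit[OF M] base_expansion_trailing_digit[OF kM]
    by (simp_all add: a_def b_def hd_rev)
  then have cong: "(k * b) mod g = a"
    by (metis mod_mult_right_eq)
  have M_bounds: "a * P \<le> M" "M < (a + 1) * P"
    using base_expansion_leading_digit[OF M] by (simp_all add: a_def P_def)
  have kM_bounds: "b * P \<le> k * M" "k * M < (b + 1) * P"
    using base_expansion_leading_digit[OF kM] by (simp_all add: b_def P_def last_rev)
  have "0 < k"
    using cong digits by (cases k) simp_all
  have "(k * a) * P \<le> k * M"
    using M_bounds(1) by (simp add: mult.assoc)
  also note kM_bounds(2)
  finally have "k * a < b + 1"
    by (rule mult_less_cancel2[THEN iffD1, THEN conjunct2])
  then have lower: "k * a \<le> b"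
    by simp
  have "b * P < (k * (a + 1)) * P"
    using kM_bounds(1) M_bounds(2) \<open>0 < k\<close>
    by (metis le_less_trans mult.assoc mult_less_mono2)
  then have upper: "b < k * (a + 1)"
    by simp
  show thesis
    using that digits cong lower upper by blast
qed

text \<open>
  The multipliers \<open>5\<close>, \<open>6\<close> and \<open>8\<close> force \<open>a = 1\<close>, which is impossible as they are not units modulo
  \<open>10\<close>; for the multipliers \<open>2\<close>, \<open>3\<close> and \<open>7\<close> the congruence contradicts the range of \<open>b\<close>.
\<close>

lemma decimal_outer_digits_multiplier:
  assumes "1 \<le> k" "k < (10 :: nat)" "0 < a" "a < 10" "0 < b" "b < 10"
    and "(k * b) mod 10 = a" "k * a \<le> b" "b < k * (a + 1)"
  shows "k \<in> {1, 4, 9}"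
proof -
  (* The congruence determines a, so the search runs over the pairs (k, b) only. *)
  have search: "\<forall>k \<in> {2, 3, 5, 6, 7, 8 :: nat}. \<forall>b \<in> {1, 2, 3, 4, 5, 6, 7, 8, 9 :: nat}.
      \<not> (0 < (k * b) mod 10 \<and> k * ((k * b) mod 10) \<le> b \<and> b < k * ((k * b) mod 10 + 1))"
    by simp
  have "b \<in> {1, 2, 3, 4, 5, 6, 7, 8, 9}"
    using assms(5,6) by auto
  then have "k \<notin> {2, 3, 5, 6, 7, 8}"
    using search assms(3,7-9) by blast
  with assms(1,2) show ?thesis
    by auto
qed

theorem theorem2:
  fixes k :: nat
  assumes "1 \<le> k" and "k < 10"
  shows "(\<exists>M::nat. M > 0 \<and> reverse_multiple 10 k M) \<longleftrightarrow> k \<in> {1, 4, 9}"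
proof
  assume "\<exists>M. M > 0 \<and> reverse_multiple 10 k M"
  then obtain M where "reverse_multiple 10 k M"
    by blast
  then show "k \<in> {1, 4, 9}"
    by (rule reverse_multiple_outer_digits) (rule decimal_outer_digits_multiplier[OF assms])
next
  have "reverse_multiple 10 1 1"
    unfolding reverse_multiple_def is_base_expansion_def
    by (intro conjI exI[of _ "[1]"]) simp_all
  moreover have "reverse_multiple 10 4 2178"
    unfolding reverse_multiple_def is_base_expansion_def
    by (intro conjI exI[of _ "[8, 7, 1, 2]"]) simp_all
  moreover have "reverse_multiple 10 9 1089"
    unfolding reverse_multiple_def is_base_expansion_def
    by (intro conjI exI[of _ "[9, 8, 0, 1]"]) simp_all
  moreover assume "k \<in> {1, 4, 9}"
  ultimately have "\<exists>M. reverse_multiple 10 k M"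
    by blast
  then show "\<exists>M. M > 0 \<and> reverse_multiple 10 k M"
    unfolding reverse_multiple_def by blast
qed

end
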